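(* For every $\epsilon>0$ there exists $N_\epsilon\in\mathbb N$ such that for every integer $n\geq N_\epsilon$, $$r_n\geq \exp\!\left[-\sqrt n\left(\log n+\log\frac{2}{\log 2}+\epsilon\right)\right].$$
   Context: For a polynomial $Q(t)=\sum_k q_k t^k$ with complex coefficients, $\|Q\|_{H^2}=\bigl(\sum_k |q_k|^2\bigr)^{1/2}$. For an integer $n\ge 1$, $\mathcal P_n$ denotes the class of complex polynomials $P$ of degree $n$ such that $P(0)=1$ and all zeros of $P$ lie in the closed unit disk $\{w\in\mathbb C:|w|\le 1\}$ (zeros on the unit circle are allowed). For $P\in\mathcal P_n$ define the normalized residual $$\rho(P)=\frac{\|P'-P'(0)P\|_{H^2}}{\|P\|_{H^2}},\qquad r_n=\inf_{P\in\mathcal P_n}\rho(P).$$ $\log$ is the natural logarithm. *)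

theory Defs
  imports Complex_Main "HOL-Computational_Algebra.Polynomial"
begin

definition H2_norm :: "complex poly \<Rightarrow> real" where
  "H2_norm Q = sqrt (\<Sum>k\<le>degree Q. (cmod (coeff Q k))\<^sup>2)"

definition poly_class :: "nat \<Rightarrow> complex poly set" where
  "poly_class n = {P. degree P = n \<and> poly P 0 = 1 \<and>
     (\<forall>w. poly P w = 0 \<longrightarrow> cmod w \<le> 1)}"

definition residual :: "complex poly \<Rightarrow> real" where
  "residual P = H2_norm (pderiv P - smult (poly (pderiv P) 0) P) / H2_norm P"

text \<open>The infimum is the conditionally complete one on the reals, which is meaningful only
  for a nonempty set bounded below; the two lemmas after the definition establish this.\<close>

definition min_residual :: "nat \<Rightarrow> real" where
  "min_residual n = (INF P\<in>poly_class n. residual P)"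

lemma poly_class_nonempty:
  assumes "n \<ge> 1"
  shows "poly_class n \<noteq> {}"
proof -
  let ?P = "1 + monom 1 n :: complex poly"
  have "degree ?P = n"
    using assms by (subst degree_add_eq_right) (auto simp: degree_monom_eq)
  moreover have "poly ?P 0 = 1"
    using assms by (simp add: poly_monom)
  moreover have "cmod w \<le> 1" if "poly ?P w = 0" for w
  proof -
    have "w ^ n = - 1"
      using that by (simp add: poly_monom eq_neg_iff_add_eq_0 add.commute)
    then have "cmod w ^ n = 1"
      by (metis norm_minus_cancel norm_one norm_power)
    then show ?thesis
      using assms by (metis norm_ge_zero not_le one_less_power less_irrefl less_le_trans zero_less_one)
  qed
  ultimately have "?P \<in> poly_class n"
    by (simp add: poly_class_def)
  then show ?thesis
    by blast
qed

lemma bdd_below_residual: "bdd_below (residual ` poly_class n)"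
  by (rule bdd_belowI2[of _ 0]) (simp add: residual_def H2_norm_def sum_nonneg)

end

theory Submission
  imports Defs "HOL-Computational_Algebra.Fundamental_Theorem_Algebra"
    "HOL-Complex_Analysis.Complex_Analysis" "HOL-Real_Asymp.Real_Asymp"
begin

text \<open>
  Write \<open>c = P'(0)\<close> and \<open>R = P' - c P\<close>. If the residual is tiny, then \<open>P\<close> behaves like the
  zero-free function \<open>exp (c z)\<close> wherever \<open>|P|\<close> is large on the unit circle, and this conflicts with
  \<open>P\<close> having \<open>n\<close> zeros, all in the closed unit disk. The conflict is seen locally, near one point.

  Choose \<open>z0\<close> on the unit circle where \<open>|P|\<close> is comparable to the norm of \<open>P\<close>. Since
  differentiation has norm at most \<open>n\<close> on polynomials of degree \<open>n\<close>, we have \<open>|c| \<le> n + 1\<close>.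
  Integrating \<open>P' = c P + R\<close> from \<open>z0\<close> shows that in the disk of radius \<open>\<delta>\<close> around \<open>z0\<close> the
  polynomial \<open>P\<close> has no zeros and \<open>|P'/P - c| = |R/P| \<le> \<eta>\<close>, where \<open>\<eta>\<close> is the residual times
  \<open>exp (2 n \<delta>)\<close>, up to lower order factors
  (\<open>norm_poly_ge_of_nearly_exponential\<close>).

  Let \<open>w 1, \<dots>, w n\<close> be the zeros and \<open>b i = z0/(z0 - w i)\<close>. As \<open>P'/P\<close> is the sum of the
  \<open>1/(z - w i)\<close>, the Cauchy inequality turns the estimate for \<open>P'/P - c\<close> into
  \<open>|\<Sum>i. b i^(k + 1)| \<le> \<eta>/\<delta>^k\<close> for all \<open>k \<ge> 1\<close>: all power sums but the first are small
  (\<open>power_sums_small_of_nearly_constant\<close>). On the other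
  hand \<open>|w i| \<le> 1\<close> means \<open>Re (b i) \<ge> 1/2\<close>, and \<open>|b i| \<le> 1/\<delta>\<close> because the disk contains no
  zero. On this region the variable \<open>b\<close> is approximated by polynomials divisible by \<open>b^2\<close>, namely by
  \<open>b - b (1 - \<tau> b)^(2 n)\<close> with \<open>\<tau> = \<delta>^2/2\<close>. Summing over the zeros bounds
  \<open>\<Sum>i. Re (b i)\<close>, which is at least \<open>n/2\<close>, by the approximation error
  \<open>(n/\<delta>) exp (- n \<delta>^2/4)\<close> plus the contribution \<open>\<eta> exp (n \<delta>)\<close> of the higher power sums
  (\<open>power_sum_half_plane_bound\<close>, \<open>residual_tradeoff\<close>).

  For \<open>\<delta> = ln n / (4 sqrt n)\<close> and residual at most \<open>exp (- sqrt n * ln n)\<close> both terms tend to zero, a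
  contradiction. Hence \<open>exp (- sqrt n * ln n)\<close> is a lower bound for all large \<open>n\<close>, and the bound
  of the theorem is smaller because \<open>2/ln 2 > 1\<close>.
\<close>

section \<open>Coefficient norm and size on the plane\<close>

lemma H2_norm_eq_L2_set:
  assumes "degree Q \<le> N"
  shows "H2_norm Q = L2_set (\<lambda>k. cmod (coeff Q k)) {..N}"
proof -
  have "(\<Sum>k\<le>degree Q. (cmod (coeff Q k))\<^sup>2) = (\<Sum>k\<le>N. (cmod (coeff Q k))\<^sup>2)"
    by (rule sum.mono_neutral_left) (use assms in \<open>auto simp: coeff_eq_0\<close>)
  then show ?thesis
    by (simp add: H2_norm_def L2_set_def)
qed

lemma H2_norm_nonneg: "0 \<le> H2_norm Q"
  by (simp add: H2_norm_eq_L2_set[OF order_refl])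

lemma H2_norm_smult: "H2_norm (smult c Q) = cmod c * H2_norm Q"
  by (simp add: H2_norm_eq_L2_set[of _ "degree Q"] degree_smult_le norm_mult L2_set_right_distrib)

lemma H2_norm_diff_le: "H2_norm (p - q) \<le> H2_norm p + H2_norm q"
proof -
  let ?N = "max (degree p) (degree q)"
  have "H2_norm (p - q) = L2_set (\<lambda>k. cmod (coeff p k - coeff q k)) {..?N}"
    by (simp add: H2_norm_eq_L2_set[of _ ?N] degree_diff_le)
  also have "\<dots> \<le> L2_set (\<lambda>k. cmod (coeff p k) + cmod (coeff q k)) {..?N}"
    by (intro L2_set_mono norm_triangle_ineq4) auto
  also have "\<dots> \<le> L2_set (\<lambda>k. cmod (coeff p k)) {..?N} + L2_set (\<lambda>k. cmod (coeff q k)) {..?N}"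
    by (rule L2_set_triangle_ineq)
  also have "\<dots> = H2_norm p + H2_norm q"
    by (simp add: H2_norm_eq_L2_set[of _ ?N])
  finally show ?thesis .
qed

lemma H2_norm_pderiv_le: "H2_norm (pderiv p) \<le> real (degree p) * H2_norm p"
proof (cases "degree p")
  case 0
  then have "pderiv p = 0"
    by (simp add: pderiv_eq_0_iff)
  then show ?thesis
    using H2_norm_nonneg[of p] by (simp add: H2_norm_def[of 0])
next
  case (Suc m)
  have "H2_norm (pderiv p) = L2_set (\<lambda>k. cmod (coeff (pderiv p) k)) {..m}"
    by (rule H2_norm_eq_L2_set) (simp add: degree_pderiv Suc)
  also have "\<dots> \<le> L2_set (\<lambda>k. real (Suc m) * cmod (coeff p (Suc k))) {..m}"
    unfolding coeff_pderiv norm_mult norm_of_nat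
    by (intro L2_set_mono mult_right_mono) auto
  also have "\<dots> = real (Suc m) * L2_set (\<lambda>k. cmod (coeff p (Suc k))) {..m}"
    by (simp add: L2_set_right_distrib)
  also have "L2_set (\<lambda>k. cmod (coeff p (Suc k))) {..m} \<le> H2_norm p"
    unfolding H2_norm_eq_L2_set[OF eq_refl[OF Suc]] L2_set_def
    by (simp only: sum.atMost_Suc_shift) simp
  finally show ?thesis
    by (simp add: Suc)
qed

lemma norm_coeff_le_H2_norm: "cmod (coeff Q k) \<le> H2_norm Q"
proof (cases "k \<le> degree Q")
  case True
  then show ?thesis
    unfolding H2_norm_eq_L2_set[OF order_refl] by (intro member_le_L2_set) auto
next
  case False
  then show ?thesis
    by (simp add: coeff_eq_0 H2_norm_nonneg)
qed

lemma norm_poly_le_H2_norm: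
  assumes "degree Q \<le> n" "cmod z \<le> r" "1 \<le> r"
  shows "cmod (poly Q z) \<le> real (n + 1) * H2_norm Q * r ^ n"
proof -
  have "cmod (poly Q z) \<le> (\<Sum>k\<le>degree Q. cmod (coeff Q k) * cmod z ^ k)"
    unfolding poly_altdef by (rule norm_sum[THEN order_trans]) (simp add: norm_mult norm_power)
  also have "\<dots> \<le> (\<Sum>k\<le>degree Q. H2_norm Q * r ^ n)"
  proof (intro sum_mono mult_mono norm_coeff_le_H2_norm)
    fix k assume "k \<in> {..degree Q}"
    then have "k \<le> n"
      using assms by auto
    have "cmod z ^ k \<le> r ^ k"
      using assms by (intro power_mono) auto
    also have "\<dots> \<le> r ^ n"
      using assms \<open>k \<le> n\<close> by (intro power_increasing) auto
    finally show "cmod z ^ k \<le> r ^ n" .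
  qed (auto simp: H2_norm_nonneg)
  also have "\<dots> = real (degree Q + 1) * (H2_norm Q * r ^ n)"
    by simp
  also have "\<dots> \<le> real (n + 1) * (H2_norm Q * r ^ n)"
    using assms by (intro mult_right_mono) (auto simp: H2_norm_nonneg)
  finally show ?thesis
    by (simp add: mult_ac)
qed

lemma higher_deriv_poly:
  fixes p :: "complex poly"
  shows "(deriv ^^ k) (poly p) = poly ((pderiv ^^ k) p)"
proof (induction k)
  case (Suc k)
  have "deriv (poly q) = poly (pderiv q)" for q :: "complex poly"
    by (rule ext) (rule DERIV_imp_deriv[OF poly_DERIV])
  with Suc show ?case
    by simp
qed simp

text \<open>Each coefficient is at most the maximum of \<open>|P|\<close> on the unit circle, by the Cauchy
  inequality; the loss of a factor \<open>n + 1\<close> is harmless next to the size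
  \<open>exp (sqrt n * ln n)\<close> of the quantities compared in the end.\<close>

lemma H2_norm_le_norm_poly_on_circle:
  fixes P :: "complex poly"
  obtains z0 where "cmod z0 = 1" "H2_norm P \<le> real (degree P + 1) * cmod (poly P z0)"
proof -
  have "\<exists>z0\<in>sphere 0 1. \<forall>z\<in>sphere 0 1. cmod (poly P z) \<le> cmod (poly P z0)"
    by (rule continuous_attains_sup) (auto intro!: continuous_intros)
  then obtain z0 where z0: "cmod z0 = 1"
    and max: "\<And>z. cmod z = 1 \<Longrightarrow> cmod (poly P z) \<le> cmod (poly P z0)"
    by auto
  have coeff_le: "cmod (coeff P k) \<le> cmod (poly P z0)" for k
  proof -
    have "cmod ((deriv ^^ k) (poly P) 0) \<le> fact k * cmod (poly P z0) / 1 ^ k"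
      by (rule Cauchy_inequality) (auto intro!: holomorphic_intros continuous_intros max)
    moreover have "(deriv ^^ k) (poly P) 0 = fact k * coeff P k"
      by (simp add: higher_deriv_poly poly_0_coeff_0 coeff_higher_pderiv pochhammer_fact)
    ultimately show ?thesis
      by (simp add: norm_mult)
  qed
  have "H2_norm P \<le> (\<Sum>k\<le>degree P. cmod (coeff P k))"
    unfolding H2_norm_eq_L2_set[OF order_refl] by (rule L2_set_le_sum) auto
  also have "\<dots> \<le> (\<Sum>k\<le>degree P. cmod (poly P z0))"
    by (intro sum_mono coeff_le)
  finally show thesis
    using z0 by (intro that[of z0]) (auto simp: algebra_simps)
qed

section \<open>Power sums of the reciprocals \<open>1/(z - w)\<close> over the zeros\<close>

lemma pderiv_prod_linear:
  fixes w :: "'i \<Rightarrow> complex"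
  assumes "finite I" "\<And>i. i \<in> I \<Longrightarrow> z \<noteq> w i"
  shows "poly (pderiv (\<Prod>i\<in>I. [:- w i, 1:])) z
    = poly (\<Prod>i\<in>I. [:- w i, 1:]) z * (\<Sum>i\<in>I. inverse (z - w i))"
  using assms
proof (induction I rule: finite_induct)
  case (insert i I)
  then have "z - w i \<noteq> 0"
    by auto
  let ?Q = "\<Prod>i\<in>I. [:- w i, 1:]"
  have "pderiv ([:- w i, 1:] * ?Q) = ?Q + [:- w i, 1:] * pderiv ?Q"
    by (simp add: pderiv_mult pderiv_pCons del: mult_pCons_left)
  then have "poly (pderiv ([:- w i, 1:] * ?Q)) z = poly ?Q z + (z - w i) * poly (pderiv ?Q) z"
    by (simp del: mult_pCons_left)
  also have "\<dots> = poly ([:- w i, 1:] * ?Q) z * (inverse (z - w i) + (\<Sum>i\<in>I. inverse (z - w i)))"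
    using insert \<open>z - w i \<noteq> 0\<close> by (simp add: field_simps del: mult_pCons_left)
  finally show ?case
    using insert.hyps by (simp del: mult_pCons_left)
qed simp

lemma DERIV_inverse_diff_power:
  fixes a z :: complex
  assumes "z \<noteq> a"
  shows "((\<lambda>z. inverse (z - a) ^ (k + 2)) has_field_derivative
    - (of_nat (k + 2) * inverse (z - a) ^ (k + 3))) (at z)"
proof -
  have "((\<lambda>z. inverse (z - a)) has_field_derivative - (inverse (z - a) ^ 2)) (at z)"
    using assms by (auto intro!: derivative_eq_intros simp: power2_eq_square)
  from DERIV_power[OF this, of "k + 2"] show ?thesis
    by (simp add: power_add power2_eq_square power3_eq_cube mult_ac)
qed

lemma higher_deriv_sum_inverse:
  fixes w :: "'i \<Rightarrow> complex"
  assumes "finite I" "\<And>i. i \<in> I \<Longrightarrow> z \<noteq> w i"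
  shows "(deriv ^^ Suc k) (\<lambda>z. (\<Sum>i\<in>I. inverse (z - w i)) - c) z
    = (- 1) ^ Suc k * fact (Suc k) * (\<Sum>i\<in>I. inverse (z - w i) ^ (k + 2))"
  using assms(2)
proof (induction k arbitrary: z)
  case 0
  have "((\<lambda>z. (\<Sum>i\<in>I. inverse (z - w i)) - c) has_field_derivative
      (\<Sum>i\<in>I. - (inverse (z - w i) ^ 2))) (at z)"
    using 0 by (auto intro!: derivative_eq_intros sum.cong simp: power2_eq_square)
  then show ?case
    by (simp add: DERIV_imp_deriv sum_negf power2_eq_square)
next
  case (Suc k)
  let ?F = "\<lambda>k z. (- 1) ^ Suc k * fact (Suc k) * (\<Sum>i\<in>I. inverse (z - w i) ^ (k + 2))"
  have "\<forall>\<^sub>F x in nhds z. x \<in> - (w ` I)"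
    using assms(1) Suc.prems
    by (intro eventually_nhds_in_open) (auto intro!: finite_imp_closed open_Compl)
  then have "\<forall>\<^sub>F x in nhds z.
      (deriv ^^ Suc k) (\<lambda>z. (\<Sum>i\<in>I. inverse (z - w i)) - c) x = ?F k x"
    by eventually_elim (rule Suc.IH, auto)
  then have "(deriv ^^ Suc (Suc k)) (\<lambda>z. (\<Sum>i\<in>I. inverse (z - w i)) - c) z = deriv (?F k) z"
    by (simp only: funpow.simps(2) o_def) (rule deriv_cong_ev, auto)
  also have "\<dots> = ?F (Suc k) z"
  proof (rule DERIV_imp_deriv)
    have "((\<lambda>z. \<Sum>i\<in>I. inverse (z - w i) ^ (k + 2)) has_field_derivative
        (\<Sum>i\<in>I. - (of_nat (k + 2) * inverse (z - w i) ^ (k + 3)))) (at z)"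
      using Suc.prems by (intro DERIV_sum DERIV_inverse_diff_power)
    from DERIV_cmult[OF this, of "(- 1) ^ Suc k * fact (Suc k)"]
    have "(?F k has_field_derivative (- 1) ^ Suc k * fact (Suc k)
        * (- (of_nat (k + 2) * (\<Sum>i\<in>I. inverse (z - w i) ^ (k + 3))))) (at z)"
      by (simp only: sum_negf sum_distrib_left)
    moreover have "(- 1) ^ Suc k * fact (Suc k) * (- (of_nat (k + 2) * S))
        = (- 1) ^ Suc (Suc k) * fact (Suc (Suc k)) * S" for S :: complex
      by (simp add: algebra_simps)
    ultimately show "(?F k has_field_derivative ?F (Suc k) z) (at z)"
      by (simp only: add_Suc add_Suc_right numeral_3_eq_3 numeral_2_eq_2)
  qed
  finally show ?case .
qed

text \<open>A logarithmic derivative \<open>P'/P\<close> that is nearly constant on a disk has small Taylor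
  coefficients beyond the constant one, and up to sign these coefficients are the power sums
  of the \<open>1/(z0 - w i)\<close>.\<close>

lemma power_sums_small_of_nearly_constant:
  fixes w :: "'i \<Rightarrow> complex"
  assumes "finite I" "0 < \<delta>" "1 \<le> k"
    and far: "\<And>i. i \<in> I \<Longrightarrow> \<delta> < cmod (z0 - w i)"
    and near: "\<And>z. cmod (z0 - z) = \<delta> \<Longrightarrow> cmod ((\<Sum>i\<in>I. inverse (z - w i)) - c) \<le> \<eta>"
  shows "cmod (\<Sum>i\<in>I. inverse (z0 - w i) ^ Suc k) \<le> \<eta> / \<delta> ^ k"
proof -
  have no_pole: "z - w i \<noteq> 0" if "z \<in> cball z0 \<delta>" "i \<in> I" for z i
    using far[OF that(2)] that(1) by (auto simp: dist_norm)
  have "cmod ((deriv ^^ k) (\<lambda>z. (\<Sum>i\<in>I. inverse (z - w i)) - c) z0) \<le> fact k * \<eta> / \<delta> ^ k"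
    by (rule Cauchy_inequality)
      (use assms no_pole in \<open>auto intro!: holomorphic_intros continuous_intros\<close>)
  moreover have "(deriv ^^ k) (\<lambda>z. (\<Sum>i\<in>I. inverse (z - w i)) - c) z0
      = (- 1) ^ k * fact k * (\<Sum>i\<in>I. inverse (z0 - w i) ^ Suc k)"
    using higher_deriv_sum_inverse[of I z0 w "k - 1" c] assms no_pole[of z0] by (cases k) auto
  ultimately have "fact k * cmod (\<Sum>i\<in>I. inverse (z0 - w i) ^ Suc k) \<le> fact k * (\<eta> / \<delta> ^ k)"
    by (simp only: norm_mult norm_power) (simp add: norm_mult norm_power)
  then show ?thesis
    by (rule mult_left_le_imp_le) simp
qed

text \<open>For \<open>|z| = 1\<close> the map \<open>w \<mapsto> z/(z - w)\<close> sends the closed unit disk without \<open>z\<close>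
  onto the half-plane \<open>Re \<ge> 1/2\<close>. The location of the zeros is used through this fact alone.\<close>

lemma Re_div_diff_ge_half:
  fixes z w :: complex
  assumes "cmod z = 1" "cmod w \<le> 1" "z \<noteq> w"
  shows "1 / 2 \<le> Re (z / (z - w))"
proof -
  have z: "(Re z)\<^sup>2 + (Im z)\<^sup>2 = 1"
    using assms(1) by (metis cmod_power2 one_power2)
  have "(cmod w)\<^sup>2 \<le> 1"
    using assms(2) by (simp add: power_le_one)
  then have w: "(Re w)\<^sup>2 + (Im w)\<^sup>2 \<le> 1"
    by (simp add: cmod_power2)
  have pos: "(Re (z - w))\<^sup>2 + (Im (z - w))\<^sup>2 > 0"
    using assms(3) by (metis cmod_power2 right_minus_eq zero_less_norm_iff zero_less_power)
  have "(Re (z - w))\<^sup>2 + (Im (z - w))\<^sup>2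
      \<le> 2 * (Re z * Re (z - w) + Im z * Im (z - w))"
    using z w by (simp add: power2_eq_square algebra_simps)
  with pos show ?thesis
    by (simp add: Re_divide field_simps)
qed

text \<open>Numbers in the half-plane \<open>Re \<ge> 1/2\<close> have a first power sum of modulus at least half their
  number. On the part of this half-plane with \<open>|b| \<le> 1/\<delta>\<close>, the factor \<open>1 - \<tau> b\<close> with a suitable
  \<open>\<tau> > 0\<close> has modulus below \<open>1\<close>, so that \<open>b (1 - \<tau> b)^(2 l)\<close> decays as \<open>l\<close> grows. Expanding
  this polynomial expresses the first power sum, up to the decaying quantity, by the higher ones;
  hence these cannot all be very small. The gain is \<open>exp (- l \<delta>^2 / 4)\<close>, the price
  is the growth \<open>exp (l \<delta>)\<close> of the binomial coefficients weighted by \<open>(\<tau>/\<delta>)^k\<close>.\<close>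

lemma power_sum_half_plane_bound:
  fixes b :: "'i \<Rightarrow> complex"
  assumes "finite I" "0 < \<delta>"
    and Re_b: "\<And>i. i \<in> I \<Longrightarrow> 1 / 2 \<le> Re (b i)"
    and norm_b: "\<And>i. i \<in> I \<Longrightarrow> cmod (b i) \<le> 1 / \<delta>"
    and small: "\<And>k. 1 \<le> k \<Longrightarrow> cmod (\<Sum>i\<in>I. b i ^ Suc k) \<le> \<eta> / \<delta> ^ k"
  shows "card I / 2 \<le> card I / \<delta> * exp (- (real l * \<delta>\<^sup>2 / 4)) + \<eta> * exp (real l * \<delta>)"
proof -
  \<comment> \<open>This value minimises \<open>1 - \<tau> + \<tau>^2/\<delta>^2\<close>, which bounds \<open>|1 - \<tau> b|^2\<close>.\<close>
  define \<tau> where "\<tau> = \<delta>\<^sup>2 / 2"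
  have "0 < \<tau>"
    using assms(2) by (simp add: \<tau>_def)
  have "0 \<le> \<eta>"
    using order_trans[OF norm_ge_zero small[of 1]] assms(2) by (simp add: zero_le_divide_iff)
  have damp: "cmod (1 - of_real \<tau> * b i) ^ (2 * l) \<le> exp (- (real l * \<delta>\<^sup>2 / 4))" if "i \<in> I" for i
  proof -
    have "(cmod (b i))\<^sup>2 \<le> (1 / \<delta>)\<^sup>2"
      by (intro power_mono norm_b that) auto
    then have "\<tau>\<^sup>2 * (cmod (b i))\<^sup>2 \<le> \<tau>\<^sup>2 * (1 / \<delta>)\<^sup>2"
      by (intro mult_left_mono) auto
    also have "\<dots> = \<delta>\<^sup>2 / 4"
      using assms(2) by (simp add: \<tau>_def power2_eq_square)
    finally have 1: "\<tau>\<^sup>2 * (cmod (b i))\<^sup>2 \<le> \<delta>\<^sup>2 / 4" .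
    have 2: "\<tau> \<le> 2 * \<tau> * Re (b i)"
      using Re_b[OF that] \<open>0 < \<tau>\<close> by (simp add: field_simps)
    have "(cmod (1 - of_real \<tau> * b i))\<^sup>2 = 1 - 2 * \<tau> * Re (b i) + \<tau>\<^sup>2 * (cmod (b i))\<^sup>2"
      unfolding cmod_power2 by (simp add: power2_eq_square algebra_simps)
    also have "\<dots> \<le> 1 + - (\<delta>\<^sup>2 / 4)"
      using 1 2 by (simp add: \<tau>_def)
    also have "\<dots> \<le> exp (- (\<delta>\<^sup>2 / 4))"
      by (rule exp_ge_add_one_self)
    finally have "((cmod (1 - of_real \<tau> * b i))\<^sup>2) ^ l \<le> exp (- (\<delta>\<^sup>2 / 4)) ^ l"
      by (intro power_mono) auto
    then show ?thesis
      by (simp add: power_mult exp_of_nat_mult[symmetric])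
  qed
  have expand: "(\<Sum>i\<in>I. b i * (1 - of_real \<tau> * b i) ^ (2 * l))
      = (\<Sum>k\<le>2 * l. of_nat (2 * l choose k) * (- of_real \<tau>) ^ k * (\<Sum>i\<in>I. b i ^ Suc k))"
    (is "?L = _")
  proof -
    have "b i * (1 - of_real \<tau> * b i) ^ (2 * l)
        = (\<Sum>k\<le>2 * l. of_nat (2 * l choose k) * (- of_real \<tau>) ^ k * b i ^ Suc k)" for i
    proof -
      have "1 - of_real \<tau> * b i = (- of_real \<tau>) * b i + 1"
        by simp
      then show ?thesis
        by (simp only: binomial_ring power_mult_distrib sum_distrib_left power_one mult_1_right
            power_Suc mult_1_left mult_ac)
    qed
    then have "?L = (\<Sum>i\<in>I. \<Sum>k\<le>2 * l. of_nat (2 * l choose k) * (- of_real \<tau>) ^ k * b i ^ Suc k)"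
      by simp
    also have "\<dots> = (\<Sum>k\<le>2 * l. \<Sum>i\<in>I. of_nat (2 * l choose k) * (- of_real \<tau>) ^ k * b i ^ Suc k)"
      by (rule sum.swap)
    finally show ?thesis
      by (simp add: sum_distrib_left)
  qed
  define T where "T = (\<Sum>k\<in>{1..2 * l}. of_nat (2 * l choose k) * (- of_real \<tau>) ^ k * (\<Sum>i\<in>I. b i ^ Suc k))"
  have "{..2 * l} = insert 0 {1..2 * l}"
    by auto
  then have split: "?L = (\<Sum>i\<in>I. b i) + T"
    unfolding expand T_def by simp
  have "cmod T \<le> (\<Sum>k\<in>{1..2 * l}. real (2 * l choose k) * \<tau> ^ k * (\<eta> / \<delta> ^ k))"
    unfolding T_def
  proof (rule sum_norm_le)
    fix k assume "k \<in> {1..2 * l}"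
    then show "cmod (of_nat (2 * l choose k) * (- of_real \<tau>) ^ k * (\<Sum>i\<in>I. b i ^ Suc k))
        \<le> real (2 * l choose k) * \<tau> ^ k * (\<eta> / \<delta> ^ k)"
      unfolding norm_mult norm_power norm_minus_cancel norm_of_nat norm_of_real
      using \<open>0 < \<tau>\<close> by (intro mult_mono small) auto
  qed
  also have "\<dots> \<le> (\<Sum>k\<le>2 * l. real (2 * l choose k) * \<tau> ^ k * (\<eta> / \<delta> ^ k))"
    using \<open>0 < \<tau>\<close> \<open>0 \<le> \<eta>\<close> assms(2) by (intro sum_mono2) auto
  also have "\<dots> = \<eta> * (1 + \<delta> / 2) ^ (2 * l)"
  proof -
    have "\<tau> / \<delta> = \<delta> / 2"
      using assms(2) by (simp add: \<tau>_def power2_eq_square)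
    then have "\<eta> * (1 + \<delta> / 2) ^ (2 * l) = \<eta> * (\<tau> / \<delta> + 1) ^ (2 * l)"
      by (simp only: add.commute)
    also have "\<dots> = (\<Sum>k\<le>2 * l. real (2 * l choose k) * \<tau> ^ k * (\<eta> / \<delta> ^ k))"
      unfolding binomial_ring by (simp add: sum_distrib_left power_divide mult_ac)
    finally show ?thesis
      by simp
  qed
  also have "\<dots> \<le> \<eta> * exp (\<delta> / 2) ^ (2 * l)"
    using \<open>0 \<le> \<eta>\<close> assms(2) by (intro mult_left_mono power_mono exp_ge_add_one_self) auto
  also have "\<dots> = \<eta> * exp (real l * \<delta>)"
    by (simp add: exp_of_nat_mult[symmetric])
  finally have T: "cmod T \<le> \<eta> * exp (real l * \<delta>)" .
  have "cmod ?L \<le> (\<Sum>i\<in>I. 1 / \<delta> * exp (- (real l * \<delta>\<^sup>2 / 4)))"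
    using assms(2)
    by (intro sum_norm_le, unfold norm_mult norm_power) (intro mult_mono norm_b damp, auto)
  then have L: "cmod ?L \<le> card I / \<delta> * exp (- (real l * \<delta>\<^sup>2 / 4))"
    by simp
  have "card I / 2 = (\<Sum>i\<in>I. 1 / 2)"
    by simp
  also have "\<dots> \<le> (\<Sum>i\<in>I. Re (b i))"
    by (intro sum_mono Re_b)
  also have "\<dots> \<le> cmod (\<Sum>i\<in>I. b i)"
    using complex_Re_le_cmod[of "\<Sum>i\<in>I. b i"] by simp
  also have "(\<Sum>i\<in>I. b i) = ?L - T"
    using split by simp
  also have "cmod (?L - T) \<le> cmod ?L + cmod T"
    by (rule norm_triangle_ineq4)
  finally show ?thesis
    using L T by linarith
qed

section \<open>A small residual makes the polynomial locally exponential\<close>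

text \<open>The function \<open>P z * exp (- c (z - z0))\<close> has derivative
  \<open>(P' - c P) z * exp (- c (z - z0))\<close>, so it is nearly constant where \<open>P' - c P\<close> is small.\<close>

lemma norm_poly_ge_of_nearly_exponential:
  fixes P :: "complex poly"
  assumes "0 \<le> K" "cmod c \<le> K"
    and res: "\<And>z. cmod (z - z0) \<le> \<delta> \<Longrightarrow> cmod (poly (pderiv P) z - c * poly P z) \<le> E"
    and z: "cmod (z - z0) \<le> \<delta>"
  shows "(cmod (poly P z0) - \<delta> * E * exp (K * \<delta>)) * exp (- (K * \<delta>)) \<le> cmod (poly P z)"
proof -
  define h where "h = (\<lambda>z. poly P z * exp (- c * (z - z0)))"
  have exponent: "cmod (c * (x - z0)) \<le> K * \<delta>" if "cmod (x - z0) \<le> \<delta>" for x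
    unfolding norm_mult using assms that by (intro mult_mono) auto
  have "0 \<le> \<delta>"
    using z norm_ge_zero order_trans by blast
  have "0 \<le> E"
    using order_trans[OF norm_ge_zero res[OF z]] .
  have "cmod (h z - h z0) \<le> E * exp (K * \<delta>) * cmod (z - z0)"
  proof (rule field_differentiable_bound[of "cball z0 \<delta>"])
    fix x assume "x \<in> cball z0 \<delta>"
    then have x: "cmod (x - z0) \<le> \<delta>"
      by (simp add: dist_norm norm_minus_commute)
    show "(h has_field_derivative (poly (pderiv P) x - c * poly P x) * exp (- c * (x - z0)))
        (at x within cball z0 \<delta>)"
      unfolding h_def by (auto intro!: derivative_eq_intros simp: algebra_simps)
    have "cmod (exp (- c * (x - z0))) \<le> exp (K * \<delta>)"
      using abs_Re_le_cmod[of "c * (x - z0)"] exponent[OF x] by simp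
    then show "cmod ((poly (pderiv P) x - c * poly P x) * exp (- c * (x - z0))) \<le> E * exp (K * \<delta>)"
      unfolding norm_mult using \<open>0 \<le> E\<close> by (intro mult_mono res x) auto
  qed (use z \<open>0 \<le> \<delta>\<close> in \<open>auto simp: dist_norm norm_minus_commute\<close>)
  also have "\<dots> \<le> E * exp (K * \<delta>) * \<delta>"
    using z \<open>0 \<le> E\<close> by (intro mult_left_mono) auto
  finally have "cmod (h z - h z0) \<le> \<delta> * E * exp (K * \<delta>)"
    by (simp add: mult_ac)
  moreover have "cmod (h z0) - cmod (h z) \<le> cmod (h z - h z0)"
    using norm_triangle_ineq2[of "h z0" "h z"] by (simp add: norm_minus_commute)
  moreover have "h z0 = poly P z0"
    by (simp add: h_def)
  ultimately have "cmod (poly P z0) - \<delta> * E * exp (K * \<delta>) \<le> cmod (h z)"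
    by simp
  then have "(cmod (poly P z0) - \<delta> * E * exp (K * \<delta>)) * exp (- (K * \<delta>)) \<le> cmod (h z) * exp (- (K * \<delta>))"
    by (rule mult_right_mono) simp
  also have "\<dots> \<le> cmod (h z) * cmod (exp (c * (z - z0)))"
    using abs_Re_le_cmod[of "c * (z - z0)"] exponent[OF z] by (intro mult_left_mono) auto
  also have "\<dots> = cmod (h z * exp (c * (z - z0)))"
    by (simp only: norm_mult)
  also have "h z * exp (c * (z - z0)) = poly P z"
    by (simp add: h_def mult.assoc exp_add[symmetric])
  finally show ?thesis .
qed

lemma degree_residual_le: "degree (pderiv P - smult c P) \<le> degree (P :: complex poly)"
  by (intro degree_diff_le degree_smult_le) (simp add: degree_pderiv)

text \<open>The parameter \<open>\<delta>\<close> is the radius of the disk around a point \<open>z0\<close> of the unit circle where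
  \<open>|P|\<close> is large, on which \<open>P\<close> is compared with an exponential; \<open>\<eta>\<close> bounds
  \<open>P'/P - P'(0)\<close> on this disk. The exponent \<open>(2 n + 1) \<delta>\<close> collects the growth \<open>n \<delta>\<close> of a
  polynomial of degree \<open>n\<close> when leaving the unit disk by \<open>\<delta>\<close> and the possible decay
  \<open>(n + 1) \<delta>\<close> of an exponential with rate \<open>|P'(0)| \<le> n + 1\<close>. In the power sum bound the
  exponent is \<open>l = n\<close>.\<close>

lemma residual_tradeoff:
  assumes P: "P \<in> poly_class n" and \<delta>: "0 < \<delta>" "\<delta> \<le> 1"
    and \<eta>: "\<eta> = 2 * (real (n + 1))\<^sup>2 * residual P * exp ((2 * real n + 1) * \<delta>)" "\<eta> \<le> 1"
  shows "real n / 2 \<le> real n / \<delta> * exp (- (real n * \<delta>\<^sup>2 / 4)) + \<eta> * exp (real n * \<delta>)"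
proof -
  have deg: "degree P = n" and P0: "poly P 0 = 1"
    and zeros: "\<And>w. poly P w = 0 \<Longrightarrow> cmod w \<le> 1"
    using P by (auto simp: poly_class_def)
  define c where "c = poly (pderiv P) 0"
  define R where "R = pderiv P - smult c P"
  define \<rho> where "\<rho> = residual P"
  have normP: "1 \<le> H2_norm P"
    using norm_coeff_le_H2_norm[of P 0] P0 by (simp add: poly_0_coeff_0)
  have normR: "H2_norm R = \<rho> * H2_norm P"
    using normP by (simp add: \<rho>_def residual_def R_def c_def)
  have "0 \<le> \<rho>"
    by (simp add: \<rho>_def residual_def H2_norm_nonneg)
  have "\<rho> \<le> 1"
  proof -
    have "1 * 1 \<le> (real (n + 1))\<^sup>2 * exp ((2 * real n + 1) * \<delta>)"
      using \<delta> by (intro mult_mono) auto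
    then have "\<rho> * 1 \<le> \<rho> * ((real (n + 1))\<^sup>2 * exp ((2 * real n + 1) * \<delta>))"
      using \<open>0 \<le> \<rho>\<close> by (intro mult_left_mono) auto
    also have "\<dots> = \<eta> / 2"
      by (simp add: \<eta>(1) \<rho>_def mult_ac)
    finally show ?thesis
      using \<eta>(2) by simp
  qed
  \<comment> \<open>Differentiation has norm at most \<open>n\<close> on polynomials of degree \<open>n\<close>, and \<open>P\<close> is nearly an
    eigenvector for the eigenvalue \<open>c\<close>.\<close>
  have normc: "cmod c \<le> real (n + 1)"
  proof -
    have "cmod c * H2_norm P = H2_norm (pderiv P - R)"
      by (simp add: H2_norm_smult[symmetric] R_def)
    also have "\<dots> \<le> H2_norm (pderiv P) + H2_norm R"
      by (rule H2_norm_diff_le)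
    also have "\<dots> \<le> real n * H2_norm P + 1 * H2_norm P"
      unfolding normR using H2_norm_pderiv_le[of P] \<open>\<rho> \<le> 1\<close> normP
      by (intro add_mono mult_right_mono) (auto simp: deg)
    finally have "cmod c * H2_norm P \<le> real (n + 1) * H2_norm P"
      by (simp add: algebra_simps)
    then show ?thesis
      by (rule mult_right_le_imp_le) (use normP in simp)
  qed
  obtain z0 where z0: "cmod z0 = 1" and M: "H2_norm P \<le> real (n + 1) * cmod (poly P z0)"
    using H2_norm_le_norm_poly_on_circle[of P] deg by metis
  define M where "M = cmod (poly P z0)"
  have "0 < M"
    using M normP by (cases "poly P z0 = 0") (auto simp: M_def)
  define E where "E = (real (n + 1))\<^sup>2 * \<rho> * M * exp (real n * \<delta>)"
  have R_le: "cmod (poly R z) \<le> E" if "cmod (z - z0) \<le> \<delta>" for z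
  proof -
    have "cmod z \<le> 1 + \<delta>"
      using norm_triangle_ineq[of z0 "z - z0"] z0 that by simp
    then have "cmod (poly R z) \<le> real (n + 1) * H2_norm R * (1 + \<delta>) ^ n"
      using degree_residual_le[of P c] deg \<delta> by (intro norm_poly_le_H2_norm) (auto simp: R_def)
    also have "\<dots> \<le> real (n + 1) * (\<rho> * (real (n + 1) * M)) * exp \<delta> ^ n"
      unfolding normR using M \<open>0 \<le> \<rho>\<close> \<delta> \<open>0 < M\<close>
      by (intro mult_mono power_mono exp_ge_add_one_self order_refl) (auto simp: M_def H2_norm_nonneg)
    also have "\<dots> = E"
      by (simp add: E_def exp_of_nat2_mult power2_eq_square mult_ac)
    finally show ?thesis .
  qed
  have E: "E * exp (real (n + 1) * \<delta>) = M * \<eta> / 2"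
  proof -
    have "(2 * real n + 1) * \<delta> = real n * \<delta> + real (n + 1) * \<delta>"
      by (simp add: algebra_simps)
    then show ?thesis
      by (simp only: E_def \<eta>(1) \<rho>_def exp_add) simp
  qed
  have "0 \<le> E"
    using \<open>0 \<le> \<rho>\<close> \<open>0 < M\<close> by (simp add: E_def)
  have P_ge: "M / 2 * exp (- (real (n + 1) * \<delta>)) \<le> cmod (poly P z)" if z: "cmod (z - z0) \<le> \<delta>" for z
  proof -
    have "\<delta> * (E * exp (real (n + 1) * \<delta>)) \<le> 1 * (M * \<eta> / 2)"
      unfolding E using \<delta> \<open>0 < M\<close> \<open>0 \<le> \<rho>\<close> by (intro mult_right_mono) (auto simp: \<eta>(1) \<rho>_def)
    also have "\<dots> \<le> M / 2"
      using \<eta>(2) \<open>0 < M\<close> by simp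
    finally have "M / 2 \<le> M - \<delta> * E * exp (real (n + 1) * \<delta>)"
      by (simp add: mult.assoc)
    then have "M / 2 * exp (- (real (n + 1) * \<delta>))
        \<le> (M - \<delta> * E * exp (real (n + 1) * \<delta>)) * exp (- (real (n + 1) * \<delta>))"
      by (rule mult_right_mono) simp
    also have "\<dots> \<le> cmod (poly P z)"
      unfolding M_def using normc R_le z
      by (intro norm_poly_ge_of_nearly_exponential[where c = c]) (auto simp: R_def)
    finally show ?thesis .
  qed
  have P_nz: "poly P z \<noteq> 0" if "cmod (z - z0) \<le> \<delta>" for z
  proof -
    have "0 < M / 2 * exp (- (real (n + 1) * \<delta>))"
      using \<open>0 < M\<close> by simp
    then show ?thesis
      using P_ge[OF that] by auto
  qed
  have quotient: "cmod (poly R z / poly P z) \<le> \<eta>" if z: "cmod (z - z0) \<le> \<delta>" for z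
  proof -
    have "cmod (poly R z / poly P z) \<le> E / (M / 2 * exp (- (real (n + 1) * \<delta>)))"
      unfolding norm_divide using R_le[OF z] P_ge[OF z] \<open>0 < M\<close> \<open>0 \<le> E\<close>
      by (intro frac_le) auto
    also have "\<dots> = E * exp (real (n + 1) * \<delta>) * 2 / M"
    proof -
      have "E / (M / 2 * inverse x) = E * x * 2 / M" for x
        by (simp add: divide_simps)
      then show ?thesis
        by (simp only: exp_minus)
    qed
    also have "\<dots> = \<eta>"
      unfolding E using \<open>0 < M\<close> by simp
    finally show ?thesis .
  qed
  obtain w where w: "P = smult (lead_coeff P) (\<Prod>i<n. [:- w i, 1:])"
    using complex_poly_decompose'[of P] deg by metis
  have root: "poly P (w i) = 0" if "i < n" for i
    by (subst w) (use that in \<open>auto simp: poly_prod\<close>)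
  have log_deriv: "poly (pderiv P) z = poly P z * (\<Sum>i<n. inverse (z - w i))"
    if "poly P z \<noteq> 0" for z
  proof -
    have "z \<noteq> w i" if "i < n" for i
      using root[OF that] \<open>poly P z \<noteq> 0\<close> by auto
    then have "poly (pderiv (\<Prod>i<n. [:- w i, 1:])) z
        = poly (\<Prod>i<n. [:- w i, 1:]) z * (\<Sum>i<n. inverse (z - w i))"
      by (intro pderiv_prod_linear) auto
    then show ?thesis
      by (subst (1 2) w) (simp add: pderiv_smult)
  qed
  have far: "\<delta> < cmod (z0 - w i)" if "i < n" for i
    using P_nz[of "w i"] root[OF that] by (force simp: norm_minus_commute)
  have power_sums: "cmod (\<Sum>i<n. inverse (z0 - w i) ^ Suc k) \<le> \<eta> / \<delta> ^ k" if "1 \<le> k" for k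
  proof (rule power_sums_small_of_nearly_constant)
    fix z assume "cmod (z0 - z) = \<delta>"
    then have z: "cmod (z - z0) \<le> \<delta>"
      by (simp add: norm_minus_commute)
    have "(\<Sum>i<n. inverse (z - w i)) - c = poly R z / poly P z"
      using log_deriv[OF P_nz[OF z]] P_nz[OF z] by (simp add: R_def field_simps)
    then show "cmod ((\<Sum>i<n. inverse (z - w i)) - c) \<le> \<eta>"
      using quotient[OF z] by simp
  qed (use far \<delta> that in auto)
  have "card {..<n} / 2
      \<le> card {..<n} / \<delta> * exp (- (real n * \<delta>\<^sup>2 / 4)) + \<eta> * exp (real n * \<delta>)"
  proof (rule power_sum_half_plane_bound[where b = "\<lambda>i. z0 / (z0 - w i)"])
    fix i assume "i \<in> {..<n}"
    then have i: "i < n"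
      by simp
    show "1 / 2 \<le> Re (z0 / (z0 - w i))"
      using z0 zeros[OF root[OF i]] far[OF i] \<delta> by (intro Re_div_diff_ge_half) auto
    show "cmod (z0 / (z0 - w i)) \<le> 1 / \<delta>"
      using z0 far[OF i] \<delta> by (simp add: norm_divide frac_le)
  next
    fix k :: nat assume k: "1 \<le> k"
    have "(\<Sum>i<n. (z0 / (z0 - w i)) ^ Suc k) = z0 ^ Suc k * (\<Sum>i<n. inverse (z0 - w i) ^ Suc k)"
      by (simp only: sum_distrib_left divide_inverse power_mult_distrib)
    then show "cmod (\<Sum>i<n. (z0 / (z0 - w i)) ^ Suc k) \<le> \<eta> / \<delta> ^ k"
      using power_sums[OF k] z0 by (simp only: norm_mult norm_power) simp
  qed (use \<delta> in auto)
  then show ?thesis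
    by simp
qed

section \<open>The choice of the radius\<close>

text \<open>With \<open>\<delta> = ln n / (4 sqrt n)\<close> and residual \<open>exp (- sqrt n * ln n)\<close>, the first term on the right
  of the tradeoff inequality is \<open>n/\<delta>\<close> times \<open>exp (- (ln n)^2 / 64)\<close>, which beats every power of
  \<open>n\<close>; the second one is of the order \<open>n^2 exp ((3/4 - 1) sqrt n * ln n)\<close>, because
  \<open>3 n \<delta> = (3/4) sqrt n * ln n\<close>. Both tend to zero, so the residual cannot be that small. Any factor
  above \<open>3\<close> in place of \<open>4\<close> would do.\<close>

lemma eventually_exp_le_residual:
  "\<forall>\<^sub>F n in sequentially. \<forall>P\<in>poly_class n. exp (- (sqrt (real n) * ln (real n))) \<le> residual P"
proof -
  define \<delta> where "\<delta> = (\<lambda>n. ln (real n) / (4 * sqrt (real n)))"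
  define \<rho> where "\<rho> = (\<lambda>n. exp (- (sqrt (real n) * ln (real n))))"
  define \<eta> where "\<eta> = (\<lambda>n r. 2 * (real (n + 1))\<^sup>2 * r * exp ((2 * real n + 1) * \<delta> n))"
  have "\<forall>\<^sub>F n in sequentially. 0 < \<delta> n"
    unfolding \<delta>_def by real_asymp
  moreover have "\<forall>\<^sub>F n in sequentially. \<delta> n \<le> 1"
    unfolding \<delta>_def by real_asymp
  moreover have "\<forall>\<^sub>F n in sequentially. \<eta> n (\<rho> n) \<le> 1"
    unfolding \<eta>_def \<rho>_def \<delta>_def by real_asymp
  moreover have "\<forall>\<^sub>F n in sequentially.
      real n / \<delta> n * exp (- (real n * (\<delta> n)\<^sup>2 / 4))
        + 2 * (real (n + 1))\<^sup>2 * \<rho> n * exp ((3 * real n + 1) * \<delta> n) < real n / 2"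
    unfolding \<rho>_def \<delta>_def by real_asymp
  ultimately show ?thesis
  proof eventually_elim
    case (elim n)
    show ?case
    proof (intro ballI, rule ccontr)
      fix P assume P: "P \<in> poly_class n"
        and "\<not> exp (- (sqrt (real n) * ln (real n))) \<le> residual P"
      then have "residual P \<le> \<rho> n"
        by (simp add: \<rho>_def)
      then have \<eta>_le: "\<eta> n (residual P) \<le> \<eta> n (\<rho> n)"
        unfolding \<eta>_def by (intro mult_right_mono mult_left_mono) auto
      have "\<eta> n (residual P) \<le> 1"
        using \<eta>_le elim(3) by (rule order_trans)
      then have "real n / 2 \<le> real n / \<delta> n * exp (- (real n * (\<delta> n)\<^sup>2 / 4))
          + \<eta> n (residual P) * exp (real n * \<delta> n)"
        using residual_tradeoff[OF P elim(1,2)] by (simp only: \<eta>_def)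
      also have "\<dots> \<le> real n / \<delta> n * exp (- (real n * (\<delta> n)\<^sup>2 / 4))
          + \<eta> n (\<rho> n) * exp (real n * \<delta> n)"
        using \<eta>_le by (intro add_left_mono mult_right_mono) auto
      also have "\<eta> n (\<rho> n) * exp (real n * \<delta> n)
          = 2 * (real (n + 1))\<^sup>2 * \<rho> n * exp ((3 * real n + 1) * \<delta> n)"
      proof -
        have "(3 * real n + 1) * \<delta> n = (2 * real n + 1) * \<delta> n + real n * \<delta> n"
          by (simp add: algebra_simps)
        then show ?thesis
          by (simp only: \<eta>_def exp_add mult.assoc)
      qed
      also have "real n / \<delta> n * exp (- (real n * (\<delta> n)\<^sup>2 / 4))
          + 2 * (real (n + 1))\<^sup>2 * \<rho> n * exp ((3 * real n + 1) * \<delta> n) < real n / 2"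
        by (rule elim)
      finally show False
        by simp
    qed
  qed
qed

theorem theorem1p1:
  fixes \<epsilon> :: real
  assumes "\<epsilon> > 0"
  shows "\<exists>N::nat. \<forall>n::nat. n \<ge> N \<longrightarrow>
    min_residual n \<ge> exp (- (sqrt (real n) * (ln (real n) + ln (2 / ln 2) + \<epsilon>)))"
proof -
  have "0 \<le> ln (2 / ln 2 :: real)"
    using ln_2_less_1 by (simp add: field_simps)
  obtain N where N: "\<And>n P. n \<ge> N \<Longrightarrow> P \<in> poly_class n \<Longrightarrow>
      exp (- (sqrt (real n) * ln (real n))) \<le> residual P"
    using eventually_exp_le_residual unfolding eventually_sequentially by blast
  have "exp (- (sqrt (real n) * (ln (real n) + ln (2 / ln 2) + \<epsilon>))) \<le> min_residual n"
    if n: "n \<ge> max N 1" for n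
  proof -
    have "exp (- (sqrt (real n) * (ln (real n) + ln (2 / ln 2) + \<epsilon>)))
        \<le> exp (- (sqrt (real n) * ln (real n)))"
      using assms \<open>0 \<le> ln (2 / ln 2)\<close> by (simp add: mult_left_mono)
    also have "\<dots> \<le> min_residual n"
      unfolding min_residual_def using n poly_class_nonempty[of n] N[of n]
      by (intro cINF_greatest) auto
    finally show ?thesis .
  qed
  then show ?thesis
    by blast
qed

end
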